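(* Let $d\ge1$, let $\mathcal{L}_1,\dots,\mathcal{L}_n$ be sublattices of $\mathbb{Z}^d$ and let $\mathbf{v}_1,\dots,\mathbf{v}_n\in\mathbb{Z}^d$. Then $\mathbf{v}_1+\mathcal{L}_1,\dots,\mathbf{v}_n+\mathcal{L}_n$ is a lattice tiling of $\mathbb{Z}^d$ if and only if for every $\mathbf{z}\in\mathbb{T}^d$ such that the character $\chi_{\mathbf{z}}$ has finite order, $$\sum_{j\,:\,\mathbf{z}\in\widehat{G}_{\mathcal{L}_j}}\frac{\chi_{\mathbf{z}}(\mathbf{v}_j)}{\det\mathcal{L}_j}=\begin{cases}1,&\text{if }\mathbf{z}=(1,\dots,1),\\ 0,&\text{otherwise.}\end{cases}$$
   Context: A sublattice is a full-rank (equivalently finite-index) subgroup of $\mathbb{Z}^d$. Its determinant $\det\mathcal{L}$ is its index in $\mathbb{Z}^d$. A collection $\mathbf{v}_1+\mathcal{L}_1,\dots,\mathbf{v}_n+\mathcal{L}_n$ (where $\mathbf{v}+\mathcal{L}=\{\mathbf{v}+\mathbf{w}:\mathbf{w}\in\mathcal{L}\}$) is a lattice tiling of $\mathbb{Z}^d$ if these sets are pairwise disjoint (for distinct indices) and their union is $\mathbb{Z}^d$. Let $\mathbb{T}^d=\{(z_1,\dots,z_d)\in\mathbb{C}^d: |z_1|=\dots=|z_d|=1\}$. For $\mathbf{z}\in\mathbb{T}^d$ and $\mathbf{v}=(v_1,\dots,v_d)\in\mathbb{Z}^d$ put $\chi_{\mathbf{z}}(\mathbf{v})=z_1^{v_1}\cdots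 z_d^{v_d}$. The character $\chi_{\mathbf{z}}:\mathbb{Z}^d\to\mathbb{T}$ has finite order if each $z_j$ is a root of unity. For a sublattice $\mathcal{L}$, $\widehat{G}_{\mathcal{L}}$ denotes the group of dual points of $\mathcal{L}$, i.e. $\widehat{G}_{\mathcal{L}}=\{\mathbf{z}\in\mathbb{T}^d: \chi_{\mathbf{z}}(\mathbf{v})=1\text{ for all }\mathbf{v}\in\mathcal{L}\}$. An empty sum is $0$. *)

theory Defs
  imports
    "HOL-Analysis.Analysis"
    "HOL-Algebra.Coset"
begin

text \<open>
  The ambient lattice is the type \<open>int ^ 'd\<close> with \<open>'d\<close> an arbitrary finite index type; as every
  type is inhabited, the dimension \<open>CARD('d)\<close> is at least 1.
\<close>

definition int_lattice :: "(int ^ 'd) monoid" where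
  "int_lattice = \<lparr>carrier = UNIV, monoid.mult = (+), one = 0\<rparr>"

text \<open>A subgroup of the integer lattice has full rank iff its index is finite; the latter is used here.\<close>

definition sublattice :: "(int ^ 'd) set \<Rightarrow> bool" where
  "sublattice L \<longleftrightarrow> subgroup L int_lattice \<and> finite (rcosets\<^bsub>int_lattice\<^esub> L)"

definition lattice_det :: "(int ^ 'd) set \<Rightarrow> nat" where
  "lattice_det L = card (rcosets\<^bsub>int_lattice\<^esub> L)"

definition translate :: "int ^ 'd \<Rightarrow> (int ^ 'd) set \<Rightarrow> (int ^ 'd) set" where
  "translate v L = {v + w |w. w \<in> L}"

definition lattice_tiling :: "nat \<Rightarrow> (nat \<Rightarrow> int ^ 'd) \<Rightarrow> (nat \<Rightarrow> (int ^ 'd) set) \<Rightarrow> bool" where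
  "lattice_tiling n v L \<longleftrightarrow>
     disjoint_family_on (\<lambda>j. translate (v j) (L j)) {1..n} \<and>
     (\<Union>j\<in>{1..n}. translate (v j) (L j)) = UNIV"

definition torus :: "(complex ^ 'd) set" where
  "torus = {z. \<forall>i. cmod (z $ i) = 1}"

definition character :: "complex ^ 'd \<Rightarrow> int ^ 'd \<Rightarrow> complex" where
  "character z v = (\<Prod>i\<in>UNIV. (z $ i) powi (v $ i))"

definition finite_order_character :: "complex ^ 'd \<Rightarrow> bool" where
  "finite_order_character z \<longleftrightarrow> (\<forall>i. \<exists>m>0. (z $ i) ^ m = 1)"

definition dual_points :: "(int ^ 'd) set \<Rightarrow> (complex ^ 'd) set" where
  "dual_points L = {z \<in> torus. \<forall>v\<in>L. character z v = 1}"

end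

theory Submission
  imports Defs "HOL-Algebra.Multiplicative_Group"
begin

text \<open>
  The theorem is uniqueness of Fourier coefficients on a finite abelian group. Let \<open>f(x)\<close> be the
  number of indices \<open>j\<close> with \<open>x \<in> v\<^sub>j + L\<^sub>j\<close>; the translates tile iff \<open>f\<close> is constantly 1.
  By Lagrange's theorem \<open>det L \<cdot> \<int>\<^sup>d \<subseteq> L\<close>, so with \<open>N\<close> the product of all determinants every \<open>L\<^sub>j\<close>
  contains \<open>N\<int>\<^sup>d\<close>, and \<open>f\<close> is a function on \<open>(\<int>/N)\<^sup>d\<close>, whose characters are the \<open>\<chi>\<^sub>z\<close> with all \<open>z\<^sub>i\<close>
  being \<open>N\<close>-th roots of unity.

  Averaging the indicator of a translate \<open>v + L\<close> against such a \<open>\<chi>\<^sub>z\<close> gives \<open>\<chi>\<^sub>z(v) / det L\<close> if \<open>z\<close> is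
  a dual point of \<open>L\<close>, because \<open>\<chi>\<^sub>z\<close> is then constant on the translate and the translate has
  density \<open>1 / det L\<close>; otherwise it gives 0, because translating by an element of \<open>L\<close> on which
  \<open>\<chi>\<^sub>z\<close> is not 1 multiplies the average by a number other than 1 (\<open>translate_char_sum\<close>). Hence the
  left-hand side of the claimed identity is the Fourier coefficient of \<open>f\<close> at \<open>z\<close>, and the
  right-hand side is that of the constant function 1, the translate of the lattice \<open>\<int>\<^sup>d\<close> itself.
  A function on \<open>(\<int>/N)\<^sup>d\<close> is determined by these coefficients (\<open>fourier_zero\<close>).

  The remaining points \<open>z\<close> of finite order say nothing: since \<open>N\<int>\<^sup>d \<subseteq> L\<^sub>j\<close>, all dual points of
  \<open>L\<^sub>j\<close> have \<open>N\<close>-th roots of unity as coordinates, so both sides of the identity are 0 elsewhere.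
\<close>

section \<open>Characters\<close>

lemma character_add:
  assumes "\<And>i. z $ i \<noteq> 0"
  shows "character z (x + y) = character z x * character z y"
  unfolding character_def by (simp add: power_int_add assms prod.distrib)

lemma character_mult: "character (z * w) x = character z x * character w x"
  unfolding character_def by (simp add: power_int_mult_distrib prod.distrib)

lemma character_zero [simp]: "character z 0 = 1"
  unfolding character_def by simp

lemma character_axis: "character z (axis i k) = (z $ i) powi k"
proof -
  have "character z (axis i k) = (\<Prod>j\<in>UNIV. if j = i then (z $ i) powi k else 1)"
    unfolding character_def by (intro prod.cong) (auto simp: axis_def)
  then show ?thesis by simp
qed

lemma character_axis_left: "character (\<chi> j. if j = i then c else 1) x = c powi (x $ i)"
proof -
  have "character (\<chi> j. if j = i then c else 1) x = (\<Prod>j\<in>UNIV. if j = i then c powi (x $ i) else 1)"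
    unfolding character_def by (intro prod.cong) auto
  then show ?thesis by simp
qed

section \<open>Functions on the lattice modulo \<open>N\<close>\<close>

definition residue_box :: "nat \<Rightarrow> (int ^ 'd) set" where
  "residue_box N = {x. \<forall>i. 0 \<le> x $ i \<and> x $ i < int N}"

definition periodic :: "nat \<Rightarrow> (int ^ 'd \<Rightarrow> complex) \<Rightarrow> bool" where
  "periodic N g \<longleftrightarrow> (\<forall>x y. (\<forall>i. int N dvd x $ i - y $ i) \<longrightarrow> g x = g y)"

definition root_points :: "nat \<Rightarrow> (complex ^ 'd) set" where
  "root_points N = {z. \<forall>i. (z $ i) ^ N = 1}"

lemma periodicD: "periodic N g \<Longrightarrow> (\<And>i. int N dvd x $ i - y $ i) \<Longrightarrow> g x = g y"
  unfolding periodic_def by blast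

lemma finite_vec_coordinates:
  assumes "finite A"
  shows "finite {x :: 'a ^ 'd. \<forall>i. x $ i \<in> A}"
proof -
  have "finite (vec_lambda ` (\<Pi>\<^sub>E i\<in>(UNIV :: 'd set). A))"
    using assms by (intro finite_imageI finite_PiE) auto
  moreover have "{x :: 'a ^ 'd. \<forall>i. x $ i \<in> A} \<subseteq> vec_lambda ` (\<Pi>\<^sub>E i\<in>(UNIV :: 'd set). A)"
  proof
    fix x :: "'a ^ 'd"
    assume "x \<in> {x. \<forall>i. x $ i \<in> A}"
    then have "vec_nth x \<in> (\<Pi>\<^sub>E i\<in>UNIV. A)" by auto
    then show "x \<in> vec_lambda ` (\<Pi>\<^sub>E i\<in>UNIV. A)" by (metis image_eqI vec_nth_inverse)
  qed
  ultimately show ?thesis by (rule rev_finite_subset)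
qed

lemma finite_residue_box: "finite (residue_box N :: (int ^ 'd) set)"
proof -
  have "residue_box N = {x :: int ^ 'd. \<forall>i. x $ i \<in> {0..<int N}}"
    unfolding residue_box_def by auto
  then show ?thesis using finite_vec_coordinates[of "{0..<int N}", where ?'d = 'd] by simp
qed

lemma zero_in_residue_box: "N > 0 \<Longrightarrow> 0 \<in> residue_box N"
  unfolding residue_box_def by simp

lemma card_residue_box_pos: "N > 0 \<Longrightarrow> card (residue_box N :: (int ^ 'd) set) > 0"
  using zero_in_residue_box finite_residue_box card_gt_0_iff by blast

text \<open>
  Summing over the box is summing over the group \<open>(\<int>/N)\<^sup>d\<close>, hence invariant under translation:
  translating and reducing modulo \<open>N\<close> permutes the box.
\<close>
lemma sum_box_shift:
  fixes w :: "int ^ 'd"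
  assumes N: "N > 0" and g: "periodic N g"
  shows "(\<Sum>x\<in>residue_box N. g (x + w)) = (\<Sum>x\<in>residue_box N. g x)"
proof (rule sum.reindex_bij_witness
    [where i = "\<lambda>x. \<chi> i. (x $ i - w $ i) mod int N" and j = "\<lambda>x. \<chi> i. (x $ i + w $ i) mod int N"])
  fix x :: "int ^ 'd"
  assume x: "x \<in> residue_box N"
  then have mod_id: "x $ i mod int N = x $ i" for i
    unfolding residue_box_def by simp
  show "(\<chi> i. ((\<chi> i. (x $ i + w $ i) mod int N) $ i - w $ i) mod int N) = x"
    by (simp add: vec_eq_iff mod_diff_left_eq mod_id)
  show "(\<chi> i. ((\<chi> i. (x $ i - w $ i) mod int N) $ i + w $ i) mod int N) = x"
    by (simp add: vec_eq_iff mod_add_left_eq mod_id)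
  show "(\<chi> i. (x $ i + w $ i) mod int N) \<in> residue_box N"
    "(\<chi> i. (x $ i - w $ i) mod int N) \<in> residue_box N"
    unfolding residue_box_def using N by simp_all
  show "g (\<chi> i. (x $ i + w $ i) mod int N) = g (x + w)"
    by (rule periodicD[OF g]) (simp add: mod_eq_dvd_iff[symmetric])
qed

lemma root_points_nonzero: "N > 0 \<Longrightarrow> z \<in> root_points N \<Longrightarrow> z $ i \<noteq> 0"
  unfolding root_points_def by (metis (mono_tags, lifting) mem_Collect_eq power_eq_0_iff zero_neq_one
      zero_power)

lemma root_points_torus: "N > 0 \<Longrightarrow> z \<in> root_points N \<Longrightarrow> z \<in> torus"
  unfolding root_points_def torus_def using power_eq_imp_eq_norm[of _ N 1] by force

lemma root_points_finite_order: "N > 0 \<Longrightarrow> z \<in> root_points N \<Longrightarrow> finite_order_character z"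
  unfolding root_points_def finite_order_character_def by blast

lemma finite_root_points: "N > 0 \<Longrightarrow> finite (root_points N)"
  using finite_vec_coordinates[of "{c :: complex. c ^ N = 1}"] finite_roots_unity[of N]
  unfolding root_points_def by simp

lemma root_points_mult: "z \<in> root_points N \<Longrightarrow> w \<in> root_points N \<Longrightarrow> z * w \<in> root_points N"
  unfolding root_points_def by (simp add: power_mult_distrib)

lemma periodic_character:
  fixes z :: "complex ^ 'd"
  assumes "N > 0" and z: "z \<in> root_points N"
  shows "periodic N (character z)"
  unfolding periodic_def
proof (intro allI impI)
  fix x y :: "int ^ 'd"
  assume dvd: "\<forall>i. int N dvd x $ i - y $ i"
  have "(z $ i) powi (x $ i) = (z $ i) powi (y $ i)" for i
  proof -
    obtain k where "x $ i - y $ i = int N * k" using dvd by (meson dvdE)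
    then have k: "x $ i = y $ i + int N * k" by simp
    have "(z $ i) powi (int N * k) = ((z $ i) ^ N) powi k"
      by (simp add: power_int_mult)
    then have "(z $ i) powi (int N * k) = 1"
      using z unfolding root_points_def by simp
    then show ?thesis
      using root_points_nonzero[OF assms] by (simp add: k power_int_add)
  qed
  then show "character z x = character z y" unfolding character_def by simp
qed

text \<open>The characters separate 0 from the other residues: a primitive root of unity detects one coordinate.\<close>
lemma root_points_separate:
  assumes N: "N > 0" and x: "x \<in> residue_box N" "x \<noteq> 0"
  shows "\<exists>z\<in>root_points N. character z x \<noteq> 1"
proof -
  obtain i where i: "x $ i \<noteq> 0" using x(2) by (auto simp: vec_eq_iff)
  define k where "k = nat (x $ i)"
  have k: "x $ i = int k" "0 < k" "k < N"
  proof -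
    have "0 \<le> x $ i" "x $ i < int N" using x(1) unfolding residue_box_def by auto
    then show "x $ i = int k" "0 < k" "k < N" using i unfolding k_def by auto
  qed
  define c where "c = cis (2 * pi / real N)"
  have "c ^ N = 1" unfolding c_def using N by (simp add: Complex.DeMoivre)
  have "c ^ k \<noteq> 1"
  proof
    assume "c ^ k = 1"
    then have "cis (2 * pi * real k / real N) = cis 0"
      unfolding c_def by (simp add: Complex.DeMoivre mult_ac)
    then have "cos (2 * pi * real k / real N) = 1" by (simp add: complex_eq_iff)
    then obtain m :: int where "2 * pi * real k / real N = of_int m * 2 * pi"
      using cos_one_2pi_int by metis
    then have "real k = of_int m * real N" using N by (simp add: field_simps)
    then have "int k = m * int N" by (metis of_int_eq_iff of_int_mult of_int_of_nat_eq)
    then have "int N dvd int k" by simp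
    then show False using k(2,3) by (auto dest: dvd_imp_le)
  qed
  let ?z = "\<chi> j. if j = i then c else 1"
  have "?z \<in> root_points N" using \<open>c ^ N = 1\<close> unfolding root_points_def by simp
  moreover have "character ?z x \<noteq> 1" using \<open>c ^ k \<noteq> 1\<close> k by (simp add: character_axis_left)
  ultimately show ?thesis by blast
qed

lemma sum_root_points_character:
  assumes N: "N > 0" and x: "x \<in> residue_box N" "x \<noteq> 0"
  shows "(\<Sum>z\<in>root_points N. character z x) = 0"
proof -
  obtain w where w: "w \<in> root_points N" "character w x \<noteq> 1"
    using root_points_separate[OF assms] by blast
  \<comment> \<open>Multiplication by \<open>w\<close> permutes the group of root points; its inverse is multiplication by \<open>w\<^sup>N\<^sup>-\<^sup>1\<close>.\<close>
  have inv: "w * w ^ (N - 1) = 1"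
  proof -
    have "w * w ^ (N - 1) = w ^ N" using N by (cases N) simp_all
    also have "\<dots> = 1"
    proof -
      have "(w ^ n) $ i = (w $ i) ^ n" for n i by (induction n) simp_all
      then show ?thesis using w(1) unfolding root_points_def by (simp add: vec_eq_iff)
    qed
    finally show ?thesis .
  qed
  have cancel: "w * (w ^ (N - 1) * z) = z" "w ^ (N - 1) * (w * z) = z" for z
    using inv by (metis mult.assoc mult.commute mult_1_left)+
  have winv: "w ^ n \<in> root_points N" for n
    by (induction n) (use w(1) in \<open>auto intro: root_points_mult simp: root_points_def power_mult_distrib\<close>)
  have "(\<Sum>z\<in>root_points N. character z x) = (\<Sum>z\<in>root_points N. character (w * z) x)"
    by (rule sum.reindex_bij_witness[where i = "\<lambda>z. w * z" and j = "\<lambda>z. w ^ (N - 1) * z"])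
      (simp_all add: cancel w(1) winv root_points_mult del: One_nat_def)
  also have "\<dots> = character w x * (\<Sum>z\<in>root_points N. character z x)"
    by (simp add: character_mult sum_distrib_left)
  finally show ?thesis using w(2) by (simp add: algebra_simps)
qed

text \<open>
  Fourier uniqueness. The double sum of \<open>g(x + y) \<chi>\<^sub>z(x)\<close> over \<open>x\<close> and \<open>z\<close> vanishes by assumption
  when summed over \<open>x\<close> first; summed over \<open>z\<close> first it leaves only the term \<open>x = 0\<close>, a nonzero
  multiple of \<open>g(y)\<close>.
\<close>
lemma fourier_zero:
  fixes g :: "int ^ 'd \<Rightarrow> complex"
  assumes N: "N > 0" and g: "periodic N g"
    and coeff: "\<And>z. z \<in> root_points N \<Longrightarrow> (\<Sum>x\<in>residue_box N. g x * character z x) = 0"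
  shows "g y = 0"
proof -
  have shifted: "(\<Sum>x\<in>residue_box N. g (x + y) * character z x) = 0" if z: "z \<in> root_points N" for z
  proof -
    note nz = root_points_nonzero[OF N z]
    have per: "periodic N (\<lambda>x. g x * character z x)"
      using g periodic_character[OF N z] unfolding periodic_def by metis
    have "character z y * (\<Sum>x\<in>residue_box N. g (x + y) * character z x)
        = (\<Sum>x\<in>residue_box N. g (x + y) * character z (x + y))"
      by (simp add: sum_distrib_left character_add nz mult_ac)
    also have "\<dots> = 0"
      using sum_box_shift[OF N per, of y] coeff[OF z] by simp
    finally show ?thesis
      using nz unfolding character_def by simp
  qed
  have "0 = (\<Sum>z\<in>root_points N. \<Sum>x\<in>residue_box N. g (x + y) * character z x)"
    using shifted by simp
  also have "\<dots> = (\<Sum>x\<in>residue_box N. g (x + y) * (\<Sum>z\<in>root_points N. character z x))"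
    by (subst sum.swap) (simp add: sum_distrib_left)
  also have "\<dots> = (\<Sum>x\<in>{0}. g (x + y) * (\<Sum>z\<in>root_points N. character z x))"
    by (intro sum.mono_neutral_right)
      (use N in \<open>auto simp: finite_residue_box zero_in_residue_box sum_root_points_character\<close>)
  also have "\<dots> = g y * of_nat (card (root_points N :: (complex ^ 'd) set))" by simp
  finally have "g y * of_nat (card (root_points N :: (complex ^ 'd) set)) = 0" by simp
  moreover have "card (root_points N :: (complex ^ 'd) set) \<noteq> 0"
  proof -
    have "1 \<in> root_points N" unfolding root_points_def by simp
    then show ?thesis using finite_root_points[OF N] card_eq_0_iff by blast
  qed
  ultimately show ?thesis by simp
qed

section \<open>Sublattices and their translates\<close>

lemma int_lattice_comm_group: "comm_group (int_lattice :: (int ^ 'd) monoid)"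
  by (rule comm_groupI)
    (auto simp: int_lattice_def add_ac intro: exI[where x = "- _"] left_minus)

lemma int_lattice_simps [simp]:
  "carrier int_lattice = UNIV" "x \<otimes>\<^bsub>int_lattice\<^esub> y = x + y" "\<one>\<^bsub>int_lattice\<^esub> = 0"
  by (simp_all add: int_lattice_def)

lemma int_lattice_inv [simp]: "inv\<^bsub>int_lattice\<^esub> x = - (x :: int ^ 'd)"
  using comm_group.axioms(2)[OF int_lattice_comm_group]
  by (intro group.inv_equality) auto

lemma int_lattice_pow: "x [^]\<^bsub>int_lattice\<^esub> (k :: nat) = (\<chi> i. int k * x $ i)"
proof (induction k)
  case 0
  then show ?case by (simp add: vec_eq_iff nat_pow_def)
next
  case (Suc k)
  then show ?case by (simp add: nat_pow_def vec_eq_iff algebra_simps)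
qed

lemma sublattice_add: "sublattice L \<Longrightarrow> x \<in> L \<Longrightarrow> y \<in> L \<Longrightarrow> x + y \<in> L"
  unfolding sublattice_def using subgroup.m_closed by force

lemma sublattice_uminus: "sublattice L \<Longrightarrow> x \<in> L \<Longrightarrow> - x \<in> L"
  unfolding sublattice_def using subgroup.m_inv_closed by force

lemma sublattice_diff: "sublattice L \<Longrightarrow> x \<in> L \<Longrightarrow> y \<in> L \<Longrightarrow> x - y \<in> L"
  using sublattice_add[of L x "- y"] sublattice_uminus[of L y] by simp

lemma mem_translate_iff: "x \<in> translate v L \<longleftrightarrow> x - v \<in> L"
  unfolding translate_def by (auto intro: exI[where x = "x - v"])

lemma mem_translate_add_iff:
  assumes "sublattice L" "w \<in> L"
  shows "x + w \<in> translate v L \<longleftrightarrow> x \<in> translate v L"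
  using sublattice_add[OF assms(1) _ assms(2), of "x - v"]
    sublattice_diff[OF assms(1) _ assms(2), of "x + w - v"]
  by (auto simp: mem_translate_iff algebra_simps)

lemma rcosets_int_lattice: "rcosets\<^bsub>int_lattice\<^esub> L = range (\<lambda>v. translate v L)"
  unfolding RCOSETS_def r_coset_def translate_def by (auto simp: add.commute)

lemma lattice_det_pos: "sublattice L \<Longrightarrow> lattice_det L > 0"
  unfolding sublattice_def lattice_det_def rcosets_int_lattice by (simp add: card_gt_0_iff)

text \<open>Lagrange's theorem in the quotient group: its order, the determinant, annihilates it.\<close>
lemma lattice_det_multiple:
  fixes L :: "(int ^ 'd) set"
  assumes "sublattice L"
  shows "(\<chi> i. int (lattice_det L) * x $ i) \<in> L"
proof -
  interpret comm_group "int_lattice :: (int ^ 'd) monoid" by (rule int_lattice_comm_group)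
  have sub: "subgroup L int_lattice" using assms unfolding sublattice_def by simp
  then interpret normal L int_lattice by (rule subgroup_imp_normal)
  let ?Q = "int_lattice Mod L"
  interpret Q: group ?Q by (rule factorgroup_is_group)
  define D where "D = lattice_det L"
  have "order ?Q = D"
    unfolding order_def FactGroup_def D_def lattice_det_def by simp
  moreover have "L #>\<^bsub>int_lattice\<^esub> x \<in> carrier ?Q"
    unfolding FactGroup_def RCOSETS_def by auto
  ultimately have "(L #>\<^bsub>int_lattice\<^esub> x) [^]\<^bsub>?Q\<^esub> D = L"
    using Q.pow_order_eq_1 by (simp add: FactGroup_def)
  moreover have "L #>\<^bsub>int_lattice\<^esub> (x [^]\<^bsub>int_lattice\<^esub> D) = (L #>\<^bsub>int_lattice\<^esub> x) [^]\<^bsub>?Q\<^esub> D"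
    by (rule Group.hom_nat_pow[OF r_coset_hom_Mod]) (simp_all add: is_group Q.is_group)
  ultimately have "L #>\<^bsub>int_lattice\<^esub> (x [^]\<^bsub>int_lattice\<^esub> D) = L" by simp
  then have "x [^]\<^bsub>int_lattice\<^esub> D \<in> L"
    using coset_join1[OF _ _ sub, of "x [^]\<^bsub>int_lattice\<^esub> D"] subgroup.subset[OF sub] by simp
  then show ?thesis unfolding int_lattice_pow D_def .
qed

lemma sublattice_contains_multiples:
  assumes "sublattice L" "lattice_det L dvd N" "\<And>i. int N dvd x $ i"
  shows "x \<in> L"
proof -
  have "int (lattice_det L) dvd x $ i" for i
    using assms(2,3) by (meson dvd_trans int_dvd_int_iff)
  then have "x = (\<chi> i. int (lattice_det L) * (\<chi> i. x $ i div int (lattice_det L)) $ i)"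
    by (simp add: vec_eq_iff)
  then show ?thesis using lattice_det_multiple[OF assms(1)] by metis
qed

lemma periodic_indicator_translate:
  fixes L :: "(int ^ 'd) set"
  assumes "sublattice L" "lattice_det L dvd N"
  shows "periodic N (indicator (translate v L))"
  unfolding periodic_def
proof (intro allI impI)
  fix x y :: "int ^ 'd"
  assume "\<forall>i. int N dvd x $ i - y $ i"
  then have "x - y \<in> L" by (intro sublattice_contains_multiples[OF assms]) simp
  then have "y + (x - y) \<in> translate v L \<longleftrightarrow> y \<in> translate v L"
    by (intro mem_translate_add_iff[OF assms(1)])
  then show "indicator (translate v L) x = (indicator (translate v L) y :: complex)"
    by (simp add: indicator_def)
qed

text \<open>
  Every translate has density \<open>1 / det L\<close> in the box: by translation invariance all cosets meet the box
  equally often, and the \<open>det L\<close> cosets partition it.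
\<close>
lemma sum_box_indicator_translate:
  fixes L :: "(int ^ 'd) set"
  assumes N: "N > 0" and L: "sublattice L" "lattice_det L dvd N"
  shows "(\<Sum>x\<in>residue_box N. indicator (translate v L) x :: complex) =
    of_nat (card (residue_box N :: (int ^ 'd) set)) / of_nat (lattice_det L)"
proof -
  define c where "c = (\<Sum>x\<in>residue_box N. indicator (translate 0 L) x :: complex)"
  have c: "(\<Sum>x\<in>residue_box N. indicator (translate v L) x :: complex) = c" for v
  proof -
    have "indicator (translate v L) (x + v) = (indicator (translate 0 L) x :: complex)" for x
      by (simp add: indicator_def mem_translate_iff)
    then show ?thesis
      using sum_box_shift[OF N periodic_indicator_translate[OF L], of v v] unfolding c_def by simp
  qed
  interpret group "int_lattice :: (int ^ 'd) monoid"
    using int_lattice_comm_group by (rule comm_group.axioms(2))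
  let ?R = "rcosets\<^bsub>int_lattice\<^esub> L"
  have sub: "subgroup L int_lattice" and fin: "finite ?R"
    using L(1) unfolding sublattice_def by auto
  have one: "(\<Sum>C\<in>?R. indicator C x :: complex) = 1" for x
  proof -
    have "x \<in> \<Union>?R" using rcosets_part_G[OF sub] by simp
    then obtain C where C: "C \<in> ?R" "x \<in> C" by blast
    have "(indicator C' x :: complex) = (if C' = C then 1 else 0)" if "C' \<in> ?R" for C'
      using rcos_disjoint[OF sub] that C unfolding pairwise_def disjnt_def
      by (auto simp: indicator_def)
    then have "(\<Sum>C'\<in>?R. indicator C' x :: complex) = (\<Sum>C'\<in>?R. if C' = C then 1 else 0)"
      by (intro sum.cong) auto
    then show ?thesis using C(1) fin by simp
  qed
  have "of_nat (card (residue_box N :: (int ^ 'd) set))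
      = (\<Sum>x\<in>residue_box N. \<Sum>C\<in>?R. indicator C x :: complex)"
    by (simp add: one)
  also have "\<dots> = (\<Sum>C\<in>?R. \<Sum>x\<in>residue_box N. indicator C x)"
    by (rule sum.swap)
  also have "\<dots> = (\<Sum>C\<in>?R. c)"
    by (intro sum.cong) (auto simp: rcosets_int_lattice c)
  also have "\<dots> = of_nat (lattice_det L) * c"
    unfolding lattice_det_def by simp
  finally show ?thesis using lattice_det_pos[OF L(1)] by (simp add: c)
qed

text \<open>
  The Fourier coefficients of a translate, up to normalisation by the size of the box. If \<open>\<chi>\<^sub>z\<close> is
  trivial on \<open>L\<close>, it is constant on the translate and only the density matters; if
  \<open>\<chi>\<^sub>z(w) \<noteq> 1\<close> for some \<open>w \<in> L\<close>, shifting by \<open>w\<close> shows that the sum equals \<open>\<chi>\<^sub>z(w)\<close> times itself.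
\<close>
lemma translate_char_sum:
  fixes L :: "(int ^ 'd) set"
  assumes N: "N > 0" and L: "sublattice L" "lattice_det L dvd N" and z: "z \<in> root_points N"
  shows "(\<Sum>x\<in>residue_box N. indicator (translate v L) x * character z x) =
    of_nat (card (residue_box N :: (int ^ 'd) set)) *
      (if z \<in> dual_points L then character z v / of_nat (lattice_det L) else 0)"
proof (cases "z \<in> dual_points L")
  case True
  have "character z x = character z v" if "x \<in> translate v L" for x
  proof -
    have "character z (v + (x - v)) = character z v * character z (x - v)"
      by (rule character_add) (rule root_points_nonzero[OF N z])
    then show ?thesis
      using True that unfolding dual_points_def mem_translate_iff by simp
  qed
  then have "(\<Sum>x\<in>residue_box N. indicator (translate v L) x * character z x)
      = (\<Sum>x\<in>residue_box N. indicator (translate v L) x * character z v)"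
    by (intro sum.cong) (auto simp: indicator_def)
  then show ?thesis
    using True sum_box_indicator_translate[OF N L, of v] by (simp add: sum_distrib_right[symmetric])
next
  case False
  then obtain w where w: "w \<in> L" "character z w \<noteq> 1"
    using root_points_torus[OF N z] unfolding dual_points_def by blast
  let ?g = "\<lambda>x. indicator (translate v L) x * character z x"
  have per: "periodic N ?g"
    using periodic_indicator_translate[OF L, of v] periodic_character[OF N z]
    unfolding periodic_def by metis
  have "?g (x + w) = character z w * ?g x" for x
    using mem_translate_add_iff[OF L(1) w(1)]
    by (simp add: indicator_def character_add root_points_nonzero[OF N z])
  then have "(\<Sum>x\<in>residue_box N. ?g x) = character z w * (\<Sum>x\<in>residue_box N. ?g x)"
    using sum_box_shift[OF N per, of w] by (simp add: sum_distrib_left)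
  then have "(\<Sum>x\<in>residue_box N. ?g x) = 0" using w(2) by simp
  then show ?thesis using False by simp
qed

lemma sublattice_UNIV: "sublattice (UNIV :: (int ^ 'd) set)"
  and lattice_det_UNIV: "lattice_det (UNIV :: (int ^ 'd) set) = 1"
proof -
  interpret group "int_lattice :: (int ^ 'd) monoid"
    using int_lattice_comm_group by (rule comm_group.axioms(2))
  have "translate v UNIV = (UNIV :: (int ^ 'd) set)" for v
    by (auto simp: mem_translate_iff)
  then have R: "rcosets\<^bsub>int_lattice\<^esub> UNIV = {UNIV :: (int ^ 'd) set}"
    unfolding rcosets_int_lattice by auto
  then show "lattice_det (UNIV :: (int ^ 'd) set) = 1" unfolding lattice_det_def by simp
  show "sublattice (UNIV :: (int ^ 'd) set)"
    unfolding sublattice_def using R subgroup_self by simp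
qed

lemma dual_points_UNIV: "dual_points UNIV = {\<chi> i. 1}"
proof
  show "dual_points UNIV \<subseteq> {\<chi> i. 1}"
  proof
    fix z :: "complex ^ 'd"
    assume "z \<in> dual_points UNIV"
    then have "character z (axis i 1) = 1" for i unfolding dual_points_def by simp
    then show "z \<in> {\<chi> i. 1}" by (simp add: character_axis vec_eq_iff)
  qed
  show "{\<chi> i. 1} \<subseteq> (dual_points UNIV :: (complex ^ 'd) set)"
    unfolding dual_points_def torus_def character_def by simp
qed

lemma dual_points_root_points:
  assumes L: "sublattice L" "lattice_det L dvd N"
  shows "dual_points L \<subseteq> root_points N"
proof
  fix z
  assume z: "z \<in> dual_points L"
  have "(z $ i) ^ N = 1" for i
  proof -
    have "axis i (int N) \<in> L"
      by (rule sublattice_contains_multiples[OF L]) (simp add: axis_def)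
    then have "character z (axis i (int N)) = 1" using z unfolding dual_points_def by blast
    then show ?thesis by (simp add: character_axis)
  qed
  then show "z \<in> root_points N" unfolding root_points_def by simp
qed

section \<open>Tilings\<close>

lemma lattice_tiling_iff_multiplicity:
  "lattice_tiling n v L \<longleftrightarrow>
    (\<forall>x. (\<Sum>j\<in>{1..n}. indicator (translate (v j) (L j)) x :: complex) = 1)"
proof -
  have count: "(\<Sum>j\<in>{1..n}. indicator (translate (v j) (L j)) x :: complex)
      = of_nat (card {j \<in> {1..n}. x \<in> translate (v j) (L j)})" for x
    by (simp add: indicator_def sum.If_cases Int_def)
  have "lattice_tiling n v L \<longleftrightarrow> (\<forall>x. \<exists>!j. j \<in> {1..n} \<and> x \<in> translate (v j) (L j))"
    unfolding lattice_tiling_def disjoint_family_on_def by blast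
  also have "\<dots> \<longleftrightarrow> (\<forall>x. card {j \<in> {1..n}. x \<in> translate (v j) (L j)} = 1)"
    by (simp only: card_1_singleton_iff set_eq_iff mem_Collect_eq singleton_iff One_nat_def) metis
  finally show ?thesis unfolding count by (metis of_nat_1 of_nat_eq_iff)
qed

theorem theorem1p6:
  fixes n :: nat
    and L :: "nat \<Rightarrow> (int ^ 'd) set"
    and v :: "nat \<Rightarrow> int ^ 'd"
  assumes "\<And>j. j \<in> {1..n} \<Longrightarrow> sublattice (L j)"
  shows "lattice_tiling n v L \<longleftrightarrow>
    (\<forall>z\<in>torus. finite_order_character z \<longrightarrow>
       (\<Sum>j | j \<in> {1..n} \<and> z \<in> dual_points (L j).
          character z (v j) / of_nat (lattice_det (L j))) =
       (if z = (\<chi> i. 1) then 1 else 0))"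
proof -
  define N where "N = (\<Prod>j\<in>{1..n}. lattice_det (L j))"
  have N: "N > 0" unfolding N_def by (intro prod_pos) (use lattice_det_pos assms in auto)
  have dvd: "lattice_det (L j) dvd N" if "j \<in> {1..n}" for j
    unfolding N_def using that by (intro dvd_prodI) auto
  define h :: "int ^ 'd \<Rightarrow> complex" where
    "h = (\<lambda>x. (\<Sum>j\<in>{1..n}. indicator (translate (v j) (L j)) x) - 1)"
  define S where "S = (\<lambda>z. \<Sum>j | j \<in> {1..n} \<and> z \<in> dual_points (L j).
      character z (v j) / of_nat (lattice_det (L j)))"
  define \<delta> where "\<delta> = (\<lambda>z :: complex ^ 'd. if z = (\<chi> i. 1) then 1 else 0 :: complex)"
  have per: "periodic N h"
    unfolding periodic_def h_def
  proof (intro allI impI)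
    fix x y :: "int ^ 'd"
    assume "\<forall>i. int N dvd x $ i - y $ i"
    then have "(indicator (translate (v j) (L j)) x :: complex) = indicator (translate (v j) (L j)) y"
      if "j \<in> {1..n}" for j
      using periodicD[OF periodic_indicator_translate[OF assms[OF that] dvd[OF that]]] by blast
    then show "(\<Sum>j\<in>{1..n}. indicator (translate (v j) (L j)) x) - 1
        = (\<Sum>j\<in>{1..n}. indicator (translate (v j) (L j)) y) - (1 :: complex)"
      by simp
  qed
  have coeff: "(\<Sum>x\<in>residue_box N. h x * character z x)
      = of_nat (card (residue_box N :: (int ^ 'd) set)) * (S z - \<delta> z)"
    if z: "z \<in> root_points N" for z
  proof -
    let ?b = "of_nat (card (residue_box N :: (int ^ 'd) set)) :: complex"
    have "(\<Sum>x\<in>residue_box N. h x * character z x)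
        = (\<Sum>j\<in>{1..n}. \<Sum>x\<in>residue_box N. indicator (translate (v j) (L j)) x * character z x)
          - (\<Sum>x\<in>residue_box N. character z x)"
      unfolding h_def
      by (subst sum.swap) (simp add: left_diff_distrib sum_subtractf sum_distrib_right)
    also have "(\<Sum>j\<in>{1..n}. \<Sum>x\<in>residue_box N. indicator (translate (v j) (L j)) x * character z x)
        = (\<Sum>j\<in>{1..n}. ?b * (if z \<in> dual_points (L j)
            then character z (v j) / of_nat (lattice_det (L j)) else 0))"
      using translate_char_sum[OF N assms dvd z] by (intro sum.cong) auto
    also have "\<dots> = ?b * S z"
      unfolding S_def sum_distrib_left[symmetric]
      by (simp only: sum.inter_filter finite_atLeastAtMost)
    \<comment> \<open>The constant 1 is the indicator of the lattice \<open>\<int>\<^sup>d\<close>, whose only dual point is \<open>(1, \<dots>, 1)\<close>.\<close>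
    also have "(\<Sum>x\<in>residue_box N. character z x) = ?b * \<delta> z"
    proof -
      have "translate 0 UNIV = (UNIV :: (int ^ 'd) set)" by (auto simp: mem_translate_iff)
      then show ?thesis
        using translate_char_sum[OF N sublattice_UNIV _ z, of 0]
        by (simp add: lattice_det_UNIV dual_points_UNIV \<delta>_def)
    qed
    finally show ?thesis by (simp add: right_diff_distrib)
  qed
  have trivial: "S z = \<delta> z" if z: "z \<notin> root_points N" for z
  proof -
    have "z \<notin> dual_points (L j)" if "j \<in> {1..n}" for j
      using dual_points_root_points[OF assms[OF that] dvd[OF that]] z by blast
    then have "S z = 0" unfolding S_def by (intro sum.neutral) blast
    moreover have "z \<noteq> (\<chi> i. 1)" using z unfolding root_points_def by auto
    ultimately show ?thesis unfolding \<delta>_def by simp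
  qed
  have "lattice_tiling n v L \<longleftrightarrow> (\<forall>x. h x = 0)"
    unfolding lattice_tiling_iff_multiplicity h_def by simp
  also have "\<dots> \<longleftrightarrow> (\<forall>z\<in>root_points N. (\<Sum>x\<in>residue_box N. h x * character z x) = 0)"
    using fourier_zero[OF N per] by auto
  also have "\<dots> \<longleftrightarrow> (\<forall>z\<in>root_points N. S z = \<delta> z)"
    using coeff card_residue_box_pos[OF N, where ?'d = 'd] by auto
  also have "\<dots> \<longleftrightarrow> (\<forall>z\<in>torus. finite_order_character z \<longrightarrow> S z = \<delta> z)"
    using trivial root_points_torus[OF N] root_points_finite_order[OF N] by blast
  finally show ?thesis unfolding S_def \<delta>_def .
qed

end
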